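(* Exponential merging of two sorted sequences $A=(a_1,\dots,a_n)$ and $B=(b_1,\dots,b_n)$ has a worst-case fragile complexity of $O(\log n)$: every element participates in $O(\log n)$ comparisons.
   Context: Elements come from a totally ordered set and are accessed only through comparisons. Exponential merging of sorted sequences $A=(a_1,\dots,a_n)$ and $B=(b_1,\dots,b_m)$: if either is empty, output the other and stop. Otherwise (padding $B$ conceptually with virtual elements larger than $a_1$ so that its length is a power of two and some $b_i>a_1$ exists), perform an exponential search on $B$ starting at $b_1$: a doubling phase compares $a_1$ with $b_{2^0},b_{2^1},b_{2^2},\dots$ to find the smallest $k$ with $a_1<b_{2^k}$, followed by a binary search between $b_{2^{k-1}}$ and $b_{2^k}$ to find the largest $\ell$ with $b_\ell<a_1$. Output $b_1,\dots,b_\ell,a_1$ and recurse on $(b_{\ell+1},\dots,b_m)$ and $(a_2,\dots,a_n)$, with the roles of the two sequences swapped. *)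

theory Defs
  imports "HOL-Library.Landau_Symbols" "HOL-Library.Multiset"
begin

text \<open>
  Comparisons are charged to the individual entries of the two input sequences, not to their
  values, so that equal values at different places are different elements. An element is
  therefore a value together with its place of origin; only the value is used for comparing.
\<close>

datatype origin = First | Second

datatype 'a elem = Elem (origin: origin) (index: nat) (val: 'a)

definition label :: "origin \<Rightarrow> 'a list \<Rightarrow> 'a elem list" where
  "label s xs = map (\<lambda>i. Elem s i (xs ! i)) [0..<length xs]"

text \<open>
  The searched sequence is padded with virtual elements \<open>None\<close>, larger than every real element.
  Positions count from 1. No length is fixed for the padding: the search below only looks at
  positions up to the first power of two that holds a larger element, hence never beyond
  the least power of two that exceeds the length of the sequence.
\<close>

definition entry :: "'e list \<Rightarrow> nat \<Rightarrow> 'e option" where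
  "entry bs i = (if 1 \<le> i \<and> i \<le> length bs then Some (bs ! (i - 1)) else None)"

fun elem_less_entry :: "('a::linorder) elem \<Rightarrow> 'a elem option \<Rightarrow> bool" where
  "elem_less_entry x (Some b) \<longleftrightarrow> val x < val b"
| "elem_less_entry x None \<longleftrightarrow> True"

fun entry_less_elem :: "('a::linorder) elem option \<Rightarrow> 'a elem \<Rightarrow> bool" where
  "entry_less_elem (Some b) x \<longleftrightarrow> val b < val x"
| "entry_less_elem None x \<longleftrightarrow> False"

text \<open>
  The algorithms return, next to their result, the list of all comparisons made. Comparisons
  with a virtual element are recorded as well, and so count for the real element involved.
\<close>

type_synonym 'a comparisons = "('a elem \<times> 'a elem option) list"

text \<open>
  \<open>doubling x bs 0\<close> returns the least \<open>k\<close> such that \<open>x\<close> is smaller than the entry at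
  position \<open>2 ^ k\<close>.
\<close>

function doubling :: "('a::linorder) elem \<Rightarrow> 'a elem list \<Rightarrow> nat \<Rightarrow> nat \<times> 'a comparisons" where
  "doubling x bs k =
    (if elem_less_entry x (entry bs (2 ^ k)) then (k, [(x, entry bs (2 ^ k))])
     else let (k', cs) = doubling x bs (Suc k) in (k', (x, entry bs (2 ^ k)) # cs))"
  by pat_completeness auto
termination
proof (relation "measure (\<lambda>(x, bs, k). Suc (length bs) - 2 ^ k)", goal_cases)
  case (2 x bs k)
  then have "(2::nat) ^ k \<le> length bs" by (auto simp: entry_def split: if_splits)
  moreover have "(2::nat) ^ k < 2 ^ Suc k" by simp
  ultimately have "Suc (length bs) - 2 ^ Suc k < Suc (length bs) - 2 ^ k"
    by (intro diff_less_mono2) linarith+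
  then show ?case by simp
qed simp

declare doubling.simps [simp del]

text \<open>
  The entry at \<open>lo\<close> is known not to be larger than \<open>x\<close> (or \<open>lo = 0\<close>), the entry at \<open>hi\<close> is
  known not to be smaller. Unless some entry has the same value as \<open>x\<close>, the result is the
  largest position holding an entry smaller than \<open>x\<close>, or 0 if there is none.
\<close>

function binary_search ::
    "('a::linorder) elem \<Rightarrow> 'a elem list \<Rightarrow> nat \<Rightarrow> nat \<Rightarrow> nat \<times> 'a comparisons" where
  "binary_search x bs lo hi =
    (if hi - lo \<le> 1 then (lo, [])
     else let mid = (lo + hi) div 2;
              (l, cs) = (if entry_less_elem (entry bs mid) x then binary_search x bs mid hi
                         else binary_search x bs lo mid)
          in (l, (x, entry bs mid) # cs))"
  by pat_completeness auto
termination
  by (relation "measure (\<lambda>(x, bs, lo, hi). hi - lo)") auto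

declare binary_search.simps [simp del]

definition exponential_search ::
    "('a::linorder) elem \<Rightarrow> 'a elem list \<Rightarrow> nat \<times> 'a comparisons" where
  "exponential_search x bs =
    (let (k, cs1) = doubling x bs 0;
         (l, cs2) = binary_search x bs (if k = 0 then 0 else 2 ^ (k - 1)) (2 ^ k)
     in (l, cs1 @ cs2))"

function exponential_merge ::
    "('a::linorder) elem list \<Rightarrow> 'a elem list \<Rightarrow> 'a elem list \<times> 'a comparisons" where
  "exponential_merge [] bs = (bs, [])"
| "exponential_merge (a # as) [] = (a # as, [])"
| "exponential_merge (a # as) (b # bs) =
    (let (l, cs) = exponential_search a (b # bs);
         (out, cs') = exponential_merge (drop l (b # bs)) as
     in (take l (b # bs) @ a # out, cs @ cs'))"
  by pat_completeness auto
termination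
  by (relation "measure (\<lambda>(as, bs). length as + length bs)") auto

lemma take_le_if_sorted:
  assumes "sorted (map val bs)" "m \<le> length bs" "val (bs ! (m - 1)) \<le> v"
  shows "\<forall>b \<in> set (take m bs). val b \<le> v"
proof
  fix b assume "b \<in> set (take m bs)"
  then obtain i where i: "i < m" "b = bs ! i" by (auto simp: in_set_conv_nth)
  with sorted_nth_mono[OF assms(1), of i "m - 1"] assms(2) have "val b \<le> val (bs ! (m - 1))"
    by simp
  with assms(3) show "val b \<le> v" by simp
qed

lemma drop_ge_if_sorted:
  assumes "sorted (map val bs)" "m < length bs \<Longrightarrow> v \<le> val (bs ! m)"
  shows "\<forall>b \<in> set (drop m bs). v \<le> val b"
proof
  fix b assume "b \<in> set (drop m bs)"
  then obtain i where i: "i < length bs - m" "b = bs ! (m + i)" by (auto simp: in_set_conv_nth)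
  with sorted_nth_mono[OF assms(1), of m "m + i"] have "val (bs ! m) \<le> val b" by simp
  moreover have "v \<le> val (bs ! m)" using i(1) by (intro assms(2)) simp
  ultimately show "v \<le> val b" by simp
qed

lemma binary_search_split:
  assumes "lo \<le> length bs" "lo < hi"
    and "\<forall>b \<in> set (take lo bs). val b \<le> val x"
    and "\<forall>b \<in> set (drop (hi - 1) bs). val x \<le> val b"
    and "sorted (map val bs)"
  shows "fst (binary_search x bs lo hi) \<le> length bs
    \<and> (\<forall>b \<in> set (take (fst (binary_search x bs lo hi)) bs). val b \<le> val x)
    \<and> (\<forall>b \<in> set (drop (fst (binary_search x bs lo hi)) bs). val x \<le> val b)"
  using assms
proof (induction x bs lo hi rule: binary_search.induct)
  case (1 x bs lo hi)
  show ?case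
  proof (cases "hi - lo \<le> 1")
    case True
    with 1(4) have hi: "hi = Suc lo" by linarith
    from True have "fst (binary_search x bs lo hi) = lo" by (subst binary_search.simps) simp
    with 1(3,5,6) hi show ?thesis by simp
  next
    case False
    define mid where "mid = (lo + hi) div 2"
    have mid: "lo < mid" "mid < hi" using False by (auto simp: mid_def)
    show ?thesis
    proof (cases "entry_less_elem (entry bs mid) x")
      case True
      then have le: "mid \<le> length bs" "val (bs ! (mid - 1)) < val x"
        using mid by (auto simp: entry_def split: if_splits)
      have "\<forall>b \<in> set (take mid bs). val b \<le> val x"
        using take_le_if_sorted[OF 1(7) le(1)] le(2) by simp
      note IH = 1(1)[OF False mid_def True le(1) mid(2) this 1(6,7)]
      have "fst (binary_search x bs lo hi) = fst (binary_search x bs mid hi)"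
        using True False by (subst binary_search.simps) (simp add: mid_def Let_def case_prod_unfold)
      with IH show ?thesis by simp
    next
      case less: False
      have "\<forall>b \<in> set (drop (mid - 1) bs). val x \<le> val b"
        using less mid by (intro drop_ge_if_sorted[OF 1(7)]) (simp add: entry_def split: if_splits)
      note IH = 1(2)[OF False mid_def less 1(3) mid(1) 1(5) this 1(7)]
      have "fst (binary_search x bs lo hi) = fst (binary_search x bs lo mid)"
        using less False by (subst binary_search.simps) (simp add: mid_def Let_def case_prod_unfold)
      with IH show ?thesis by simp
    qed
  qed
qed

lemma doubling_least:
  assumes "\<forall>j < k. \<not> elem_less_entry x (entry bs (2 ^ j))"
  shows "fst (doubling x bs k) = (LEAST k. elem_less_entry x (entry bs (2 ^ k)))"
  using assms
proof (induction x bs k rule: doubling.induct)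
  case (1 x bs k)
  show ?case
  proof (cases "elem_less_entry x (entry bs (2 ^ k))")
    case True
    then have "(LEAST k. elem_less_entry x (entry bs (2 ^ k))) = k"
      using 1(2) by (intro Least_equality) (auto simp: not_less[symmetric])
    with True show ?thesis by (subst doubling.simps) simp
  next
    case False
    with 1 have "fst (doubling x bs (Suc k)) = (LEAST k. elem_less_entry x (entry bs (2 ^ k)))"
      by (auto simp: less_Suc_eq)
    with False show ?thesis by (subst doubling.simps) (simp add: case_prod_unfold)
  qed
qed

lemma exponential_search_split:
  assumes "sorted (map val bs)" "exponential_search x bs = (l, cs)"
  shows "l \<le> length bs"
    and "b \<in> set (take l bs) \<Longrightarrow> val b \<le> val x"
    and "b \<in> set (drop l bs) \<Longrightarrow> val x \<le> val b"
proof -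
  define P where "P = (\<lambda>k. elem_less_entry x (entry bs (2 ^ k)))"
  define k where "k = fst (doubling x bs 0)"
  have k: "k = (LEAST k. P k)" unfolding k_def P_def by (rule doubling_least) simp
  have "\<not> 2 ^ length bs \<le> length bs" by (simp add: not_le)
  then have "P (length bs)" by (simp add: P_def entry_def)
  then have Pk: "P k" unfolding k by (rule LeastI)
  define lo :: nat where "lo = (if k = 0 then 0 else 2 ^ (k - 1))"
  have lo: "lo \<le> length bs \<and> (\<forall>b \<in> set (take lo bs). val b \<le> val x)"
  proof (cases "k = 0")
    case False
    then have "\<not> P (k - 1)" using not_less_Least[of "k - 1" P] k by simp
    then have le: "lo \<le> length bs" "val (bs ! (lo - 1)) \<le> val x"
      using False by (auto simp: P_def entry_def lo_def split: if_splits)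
    then show ?thesis using take_le_if_sorted[OF assms(1)] by blast
  qed (simp add: lo_def)
  have hi: "\<forall>b \<in> set (drop (2 ^ k - 1) bs). val x \<le> val b"
    using Pk by (intro drop_ge_if_sorted[OF assms(1)])
      (auto simp: P_def entry_def split: if_splits)
  have "lo < 2 ^ k" by (simp add: lo_def)
  from binary_search_split[OF conjunct1[OF lo] this conjunct2[OF lo] hi assms(1)]
  have "l \<le> length bs \<and> (\<forall>b \<in> set (take l bs). val b \<le> val x)
      \<and> (\<forall>b \<in> set (drop l bs). val x \<le> val b)"
    using assms(2) unfolding lo_def k_def
    by (auto simp add: exponential_search_def case_prod_unfold Let_def)
  then show "l \<le> length bs" and "b \<in> set (take l bs) \<Longrightarrow> val b \<le> val x"
    and "b \<in> set (drop l bs) \<Longrightarrow> val x \<le> val b" by auto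
qed

lemma mset_exponential_merge: "mset (fst (exponential_merge as bs)) = mset as + mset bs"
proof (induction as bs rule: exponential_merge.induct)
  case (3 a as b bs)
  obtain l cs where l: "exponential_search a (b # bs) = (l, cs)" by fastforce
  let ?T = "take l (b # bs)" and ?D = "drop l (b # bs)"
  have split: "mset ?T + mset ?D = mset (b # bs)"
    by (metis append_take_drop_id mset_append)
  have "fst (exponential_merge (a # as) (b # bs)) = ?T @ a # fst (exponential_merge ?D as)"
    using l by (simp add: case_prod_unfold Let_def)
  also have "mset \<dots> = mset ?T + add_mset a (mset ?D + mset as)"
    using 3[OF l[symmetric] refl] by simp
  also have "\<dots> = (mset ?T + mset ?D) + add_mset a (mset as)" by simp
  finally show ?case by (simp only: split) simp
qed auto

lemma sorted_exponential_merge: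
  assumes "sorted (map val as)" "sorted (map val bs)"
  shows "sorted (map val (fst (exponential_merge as bs)))"
  using assms
proof (induction as bs rule: exponential_merge.induct)
  case (3 a as b bs)
  obtain l cs where l: "exponential_search a (b # bs) = (l, cs)" by fastforce
  note split = exponential_search_split[OF 3(3) l]
  let ?out = "fst (exponential_merge (drop l (b # bs)) as)"
  have out: "set ?out = set (drop l (b # bs)) \<union> set as"
    using mset_exponential_merge[of "drop l (b # bs)" as]
    by (metis set_mset_mset set_mset_union)
  have "sorted (map val ?out)"
    using 3(1)[OF l[symmetric] refl] 3(2,3) by (simp add: sorted_wrt_drop flip: drop_map)
  moreover have "val a \<le> val y" if "y \<in> set ?out" for y
    using that out split(3) 3(2) by auto
  moreover have "sorted (map val (take l (b # bs)))"
    using 3(3) by (metis sorted_wrt_take take_map)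
  ultimately have "sorted (map val (take l (b # bs) @ a # ?out))"
    using split(2) by (force simp only: map_append list.map sorted_append sorted_simps
        set_map list.set ball_simps intro: order_trans)
  with l show ?case by (simp add: case_prod_unfold Let_def)
qed auto

definition participations :: "'a elem \<Rightarrow> 'a comparisons \<Rightarrow> nat" where
  "participations e cs = length (filter (\<lambda>(x, y). x = e \<or> y = Some e) cs)"

definition exponential_merge_fragile_complexity :: "('a::linorder) list \<Rightarrow> 'a list \<Rightarrow> nat" where
  "exponential_merge_fragile_complexity A B =
    (SUP e \<in> set (label First A @ label Second B).
       participations e (snd (exponential_merge (label First A) (label Second B))))"

end

theory Submission
  imports Defs
begin

text \<open>
  Every element initiates at most one search, which costs \<open>O(log n)\<close>. If it is compared but not
  output in a search initiated by another element, then it lies in the half-open block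
  \<open>(2^(k-1), 2^k]\<close> in which the doubling phase ended, and at least \<open>2^(k-1)\<close> elements in front of
  it are output. Hence the binary logarithm of its position, rounded up, decreases with every such
  search, except that an element in first position may stay there; it then initiates the very
  next search and is output.
\<close>

section \<open>Counting participations among comparisons given by a list of positions\<close>

lemma participations_append [simp]:
  "participations e (cs @ ds) = participations e cs + participations e ds"
  by (simp add: participations_def)

lemma participations_Nil [simp]: "participations e [] = 0"
  by (simp add: participations_def)

lemma participations_le_length: "participations e cs \<le> length cs"
  by (simp add: participations_def)

lemma entry_Some_imp_nth:
  assumes "entry bs p = Some e"
  shows "1 \<le> p" "p \<le> length bs" "bs ! (p - 1) = e"
  using assms by (auto simp: entry_def split: if_splits)

lemma participations_search_eq_0:
  assumes "x \<noteq> e" "\<And>p. p \<in> set ps \<Longrightarrow> entry bs p \<noteq> Some e"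
  shows "participations e (map (\<lambda>p. (x, entry bs p)) ps) = 0"
  using assms by (auto simp: participations_def filter_empty_conv)

text \<open>In a duplicate-free sequence \<open>e\<close> sits at no more than one position, and the
  distinct positions \<open>ps\<close> contain that one at most once.\<close>

lemma participations_search_le_1:
  assumes "x \<noteq> e" "distinct bs" "distinct ps"
  shows "participations e (map (\<lambda>p. (x, entry bs p)) ps) \<le> 1"
proof -
  let ?qs = "filter (\<lambda>p. entry bs p = Some e) ps"
  have "p = q" if "entry bs p = Some e" "entry bs q = Some e" for p q
  proof -
    note p = entry_Some_imp_nth[OF that(1)] and q = entry_Some_imp_nth[OF that(2)]
    have "p - 1 = q - 1"
      using nth_eq_iff_index_eq[OF assms(2), of "p - 1" "q - 1"] p q by simp
    with p q show ?thesis by linarith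
  qed
  then have "card (set ?qs) \<le> Suc 0"
    by (subst card_le_Suc0_iff_eq) auto
  moreover have "card (set ?qs) = length ?qs"
    using assms(3) by (intro distinct_card) simp
  ultimately show ?thesis
    using assms(1) by (simp add: participations_def filter_map o_def)
qed

text \<open>Applied with \<open>m = 2 ^ k\<close>, the end of the last doubling block: it settles
  elements beyond the probed range as well as elements absent from \<open>bs\<close>.\<close>

lemma participations_search_outside_take:
  assumes "x \<noteq> e" "e \<notin> set (take m bs)" "set ps \<subseteq> {1..m}"
  shows "participations e (map (\<lambda>p. (x, entry bs p)) ps) = 0"
proof (rule participations_search_eq_0[OF assms(1)])
  fix p assume "p \<in> set ps"
  with assms(3) have p: "1 \<le> p" "p \<le> m" by auto
  show "entry bs p \<noteq> Some e"
  proof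
    assume "entry bs p = Some e"
    note p' = entry_Some_imp_nth[OF this]
    with p have "p - 1 < length (take m bs)" "take m bs ! (p - 1) = e" by auto
    then show False using assms(2) nth_mem by blast
  qed
qed

section \<open>Positions probed by an exponential search\<close>

lemma doubling_ge: "k \<le> fst (doubling x bs k)"
proof (induction x bs k rule: doubling.induct)
  case (1 x bs k)
  then show ?case by (subst doubling.simps) (auto simp: case_prod_unfold Let_def)
qed

lemma snd_doubling:
  "snd (doubling x bs k) = map (\<lambda>j. (x, entry bs (2 ^ j))) [k..<Suc (fst (doubling x bs k))]"
proof (induction x bs k rule: doubling.induct)
  case (1 x bs k)
  show ?case
  proof (cases "elem_less_entry x (entry bs (2 ^ k))")
    case True
    then show ?thesis by (subst (1 2) doubling.simps) simp
  next
    case False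
    then have eq: "doubling x bs k = (fst (doubling x bs (Suc k)),
        (x, entry bs (2 ^ k)) # snd (doubling x bs (Suc k)))"
      by (subst doubling.simps) (simp add: case_prod_unfold Let_def)
    have "k < Suc (fst (doubling x bs (Suc k)))" using doubling_ge[of "Suc k" x bs] by linarith
    then show ?thesis using 1[OF False] unfolding eq
      by (simp only: fst_conv snd_conv upt_conv_Cons list.map)
  qed
qed

text \<open>Position \<open>2 ^ L\<close> lies behind the last entry, so it is virtual and ends the
  doubling phase at the latest.\<close>

lemma fst_doubling_le:
  assumes "length bs < 2 ^ L"
  shows "fst (doubling x bs 0) \<le> L"
proof -
  have "fst (doubling x bs 0) = (LEAST k. elem_less_entry x (entry bs (2 ^ k)))"
    by (rule doubling_least) simp
  also have "\<dots> \<le> L" using assms by (intro Least_le) (simp add: entry_def)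
  finally show ?thesis .
qed

text \<open>Every probe halves the interval, which allows induction on the exponent \<open>m\<close>
  that also bounds the number of probes. A probed midpoint becomes an endpoint of the remaining open
  interval and is never probed again.\<close>

lemma binary_search_positions:
  assumes "lo < hi" "hi - lo \<le> 2 ^ m"
  shows "lo \<le> fst (binary_search x bs lo hi) \<and> fst (binary_search x bs lo hi) < hi \<and>
    (\<exists>ps. snd (binary_search x bs lo hi) = map (\<lambda>p. (x, entry bs p)) ps \<and>
      distinct ps \<and> set ps \<subseteq> {lo<..<hi} \<and> length ps \<le> m)"
  using assms
proof (induction m arbitrary: lo hi)
  case 0
  then have "binary_search x bs lo hi = (lo, [])" by (subst binary_search.simps) simp
  with 0 show ?case by simp
next
  case (Suc m)
  show ?case
  proof (cases "hi - lo \<le> 1")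
    case True
    then have "binary_search x bs lo hi = (lo, [])" by (subst binary_search.simps) simp
    with Suc.prems show ?thesis by simp
  next
    case False
    define mid where "mid = (lo + hi) div 2"
    have mid: "lo < mid" "mid < hi" using False by (auto simp: mid_def)
    have half: "hi - mid \<le> 2 ^ m" "mid - lo \<le> 2 ^ m" using Suc.prems by (auto simp: mid_def)
    \<comment> \<open>Both branches are brought into one form, so that the probes are counted only
      once.\<close>
    obtain lo' hi' where bounds: "lo \<le> lo'" "hi' \<le> hi" "lo' < hi'" "hi' - lo' \<le> 2 ^ m"
        "mid \<notin> {lo'<..<hi'}" and
      eq: "binary_search x bs lo hi = (fst (binary_search x bs lo' hi'),
        (x, entry bs mid) # snd (binary_search x bs lo' hi'))"
    proof (cases "entry_less_elem (entry bs mid) x")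
      case True
      then show ?thesis using mid half False
        by (intro that[of mid hi], simp_all,
          subst binary_search.simps, simp add: mid_def Let_def case_prod_unfold)
    next
      case less: False
      then show ?thesis using mid half False
        by (intro that[of lo mid], simp_all,
          subst binary_search.simps, simp add: mid_def Let_def case_prod_unfold)
    qed
    note IH = Suc.IH[OF bounds(3,4)]
    then obtain ps where ps:
      "snd (binary_search x bs lo' hi') = map (\<lambda>p. (x, entry bs p)) ps"
      "distinct ps" "set ps \<subseteq> {lo'<..<hi'}" "length ps \<le> m"
      by blast
    have "snd (binary_search x bs lo hi) = map (\<lambda>p. (x, entry bs p)) (mid # ps)"
      using eq ps(1) by simp
    moreover have "distinct (mid # ps)" using ps(2,3) bounds(5) by auto
    moreover have "set (mid # ps) \<subseteq> {lo<..<hi}" using mid ps(3) bounds(1,2) by fastforce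
    moreover have "length (mid # ps) \<le> Suc m" using ps(4) by simp
    moreover have "lo \<le> fst (binary_search x bs lo hi)" "fst (binary_search x bs lo hi) < hi"
      using IH bounds(1,2) by (auto simp: eq)
    ultimately show ?thesis by blast
  qed
qed

text \<open>The doubling phase makes at most \<open>L + 1\<close> probes, the binary search at most
  \<open>L\<close>. The exponent \<open>k\<close> links cost to progress: probes stay within the
  first \<open>2 ^ k\<close> positions, while for \<open>k > 0\<close> at least half as many entries
  are output.\<close>

lemma exponential_search_positions:
  assumes "length bs < 2 ^ L"
  obtains k ps where "snd (exponential_search x bs) = map (\<lambda>p. (x, entry bs p)) ps"
    and "distinct ps" and "set ps \<subseteq> {1..2 ^ k}" and "length ps \<le> 2 * L + 1"
    and "fst (exponential_search x bs) < 2 ^ k"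
    and "k > 0 \<Longrightarrow> 2 ^ (k - 1) \<le> fst (exponential_search x bs)"
proof -
  define k where "k = fst (doubling x bs 0)"
  define lo :: nat where "lo = (if k = 0 then 0 else 2 ^ (k - 1))"
  have "k \<le> L" unfolding k_def by (rule fst_doubling_le[OF assms])
  have "lo < 2 ^ k" by (simp add: lo_def)
  \<comment> \<open>For \<open>k = 0\<close> truncated subtraction turns the right-hand side into 1,
    which is the width of the interval from 0 to 1.\<close>
  have "2 ^ k - lo \<le> 2 ^ (k - 1)" by (cases k) (auto simp: lo_def)
  note bin = binary_search_positions[OF \<open>lo < 2 ^ k\<close> this, of x bs]
  obtain ps where ps: "snd (binary_search x bs lo (2 ^ k)) = map (\<lambda>p. (x, entry bs p)) ps"
      "distinct ps" "set ps \<subseteq> {lo<..<2 ^ k}" "length ps \<le> k - 1"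
    using bin by blast
  have eq: "exponential_search x bs = (fst (binary_search x bs lo (2 ^ k)),
      snd (doubling x bs 0) @ snd (binary_search x bs lo (2 ^ k)))"
    by (simp add: exponential_search_def Let_def case_prod_unfold k_def lo_def)
  define qs where "qs = map (\<lambda>j. 2 ^ j :: nat) [0..<Suc k]"
  \<comment> \<open>No power of two lies strictly between consecutive ones (for \<open>k = 0\<close>
    the interval is empty), so the two phases probe disjoint sets of positions.\<close>
  have "2 ^ j \<notin> {lo<..<2 ^ k}" for j
  proof
    assume j: "2 ^ j \<in> {lo<..<2 ^ k}"
    then have "j < k" by simp
    then have "(2::nat) ^ j \<le> lo" by (simp add: lo_def)
    with j show False by simp
  qed
  then have disj: "set qs \<inter> set ps = {}" using ps(3) by (auto simp: qs_def)
  have snd: "snd (exponential_search x bs) = map (\<lambda>p. (x, entry bs p)) (qs @ ps)"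
    unfolding eq snd_conv snd_doubling ps(1) k_def[symmetric] by (simp add: qs_def)
  have dist: "distinct (qs @ ps)"
    using disj ps(2) by (auto simp: qs_def distinct_map inj_on_def)
  have sub: "set (qs @ ps) \<subseteq> {1..2 ^ k}"
  proof -
    have "set qs \<subseteq> {1..2 ^ k}" by (auto simp: qs_def)
    moreover have "set ps \<subseteq> {1..2 ^ k}" using ps(3) by auto
    ultimately show ?thesis by simp
  qed
  have len: "length (qs @ ps) \<le> 2 * L + 1"
    using ps(4) \<open>k \<le> L\<close> by (simp add: qs_def)
  show ?thesis
    by (rule that[OF snd dist sub len]) (use bin in \<open>auto simp: eq lo_def\<close>)
qed

section \<open>Participations over the whole merge\<close>

lemma exponential_merge_Cons:
  "snd (exponential_merge (a # as) (b # bs)) = snd (exponential_search a (b # bs)) @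
    snd (exponential_merge (drop (fst (exponential_search a (b # bs))) (b # bs)) as)"
  by (simp add: case_prod_unfold Let_def)

text \<open>Used for an element that has been output: it is absent from both remaining
  lists.\<close>

lemma participations_exponential_merge_notin:
  assumes "e \<notin> set as" "e \<notin> set bs"
  shows "participations e (snd (exponential_merge as bs)) = 0"
  using assms
proof (induction as bs rule: exponential_merge.induct)
  case (3 a as b bs)
  let ?l = "fst (exponential_search a (b # bs))"
  have "e \<notin> set (drop ?l (b # bs))" using "3.prems" by (meson in_set_dropD)
  then have rest: "participations e (snd (exponential_merge (drop ?l (b # bs)) as)) = 0"
    using "3.prems" by (intro "3.IH"[OF refl prod.collapse]) auto
  \<comment> \<open>By \<open>less_exp\<close>, the length of the list itself can serve as the
    exponent \<open>L\<close>.\<close>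
  obtain k ps where ps:
      "snd (exponential_search a (b # bs)) = map (\<lambda>p. (a, entry (b # bs) p)) ps"
      "set ps \<subseteq> {1..2 ^ k}"
    using exponential_search_positions[OF less_exp] by metis
  have "participations e (snd (exponential_search a (b # bs))) = 0"
    unfolding ps(1) using "3.prems" ps(2)
    by (intro participations_search_outside_take[where m = "2 ^ k"]) (auto dest: in_set_takeD)
  with rest show ?case by (simp only: exponential_merge_Cons participations_append)
qed auto

text \<open>The head initiates the very next search and is output by it, so only the cost of this
  one search counts.\<close>

lemma participations_exponential_merge_hd:
  assumes "distinct (e # as @ bs)" "length bs < 2 ^ L"
  shows "participations e (snd (exponential_merge (e # as) bs)) \<le> 2 * L + 1"
proof (cases bs)
  case (Cons b bs')
  let ?l = "fst (exponential_search e bs)"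
  have "e \<notin> set (drop ?l bs)" using assms(1) by (auto dest: in_set_dropD)
  then have "participations e (snd (exponential_merge (drop ?l bs) as)) = 0"
    using assms(1) by (intro participations_exponential_merge_notin) auto
  moreover have "participations e (snd (exponential_search e bs)) \<le> 2 * L + 1"
  proof -
    obtain ps where "snd (exponential_search e bs) = map (\<lambda>p. (e, entry bs p)) ps"
        "length ps \<le> 2 * L + 1"
      using exponential_search_positions[OF assms(2)] by metis
    then show ?thesis
      using participations_le_length[of e "snd (exponential_search e bs)"] by simp
  qed
  ultimately show ?thesis
    unfolding Cons by (simp only: exponential_merge_Cons participations_append add_0_right)
qed simp

lemma in_set_take_mono: "e \<in> set (take m xs) \<Longrightarrow> m \<le> n \<Longrightarrow> e \<in> set (take n xs)"
  by (rule subsetD[OF set_take_subset_set_take])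

lemma in_set_take_drop:
  assumes "e \<in> set (take m xs)" "e \<notin> set (take l xs)"
  shows "e \<in> set (take (m - l) (drop l xs))"
proof -
  have "l \<le> m" using assms in_set_take_mono by (metis nat_le_linear)
  then have "take m xs = take l xs @ take (m - l) (drop l xs)"
    by (metis le_add_diff_inverse take_add)
  with assms show ?thesis by auto
qed

text \<open>The exponent \<open>t\<close> is the potential: it pays for the searches of others that
  \<open>e\<close> survives. Of the remainder, \<open>2 * L + 1\<close> pays for the search by
  \<open>e\<close> itself and 1 for a last comparison made by another element. The union in the
  hypothesis makes the claim symmetric, as the swap of roles demands.\<close>

lemma participations_exponential_merge_le:
  assumes "distinct (as @ bs)" "length as < 2 ^ L" "length bs < 2 ^ L"
    and "e \<in> set (take (2 ^ t) as) \<union> set (take (2 ^ t) bs)"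
  shows "participations e (snd (exponential_merge as bs)) \<le> t + 2 * L + 2"
  using assms
proof (induction as bs arbitrary: t rule: exponential_merge.induct)
  case (3 a as b bs)
  define B where "B = b # bs"
  define l where "l = fst (exponential_search a B)"
  have IH: "participations e (snd (exponential_merge (drop l B) as)) \<le> t' + 2 * L + 2"
    if "e \<in> set (take (2 ^ t') (drop l B)) \<union> set (take (2 ^ t') as)" for t'
  proof -
    have "distinct (drop l B @ as)" "length (drop l B) < 2 ^ L" "length as < 2 ^ L"
      using "3.prems"(1-3) set_drop_subset[of l B] unfolding B_def by auto
    then show ?thesis using that "3.IH"[OF refl prod.collapse]
      unfolding l_def B_def by blast
  qed
  have dist: "distinct B" "a \<notin> set B" "distinct (drop l B @ as)"
    using "3.prems"(1) set_drop_subset[of l B] unfolding B_def by auto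
  have total: "participations e (snd (exponential_merge (a # as) (b # bs))) =
      participations e (snd (exponential_search a B)) +
      participations e (snd (exponential_merge (drop l B) as))"
    unfolding B_def l_def by (simp only: exponential_merge_Cons participations_append)
  have "length B < 2 ^ L" using "3.prems"(3) by (simp only: B_def)
  then obtain k ps where ps: "snd (exponential_search a B) = map (\<lambda>p. (a, entry B p)) ps"
      "distinct ps" "set ps \<subseteq> {1..2 ^ k}" "l < 2 ^ k" "k > 0 \<Longrightarrow> 2 ^ (k - 1) \<le> l"
    using exponential_search_positions[of B L a] unfolding l_def by metis
  consider (head) "e = a" | (tail) "e \<noteq> a" "e \<in> set as"
    | (searched) "e \<noteq> a" "e \<in> set (take (2 ^ t) B)"
    using "3.prems"(4) in_set_takeD[of e "2 ^ t" "a # as"] unfolding B_def by auto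
  then show ?case
  proof cases
    case head
    have "distinct (a # as @ b # bs)" using "3.prems"(1) by simp
    from participations_exponential_merge_hd[OF this "3.prems"(3)] show ?thesis
      unfolding head by linarith
  next
    case tail
    then have "e \<notin> set B" using "3.prems"(1) by (auto simp: B_def)
    \<comment> \<open>Removing the head \<open>a\<close> only moves \<open>e\<close> forward, so the
      same \<open>t\<close> remains valid.\<close>
    then have "e \<in> set (take (2 ^ t) as)"
      using "3.prems"(4) tail unfolding B_def[symmetric]
      by (auto simp: take_Cons' split: if_splits intro: in_set_take_mono dest: in_set_takeD)
    then have "participations e (snd (exponential_merge (drop l B) as)) \<le> t + 2 * L + 2"
      by (intro IH) simp
    moreover have "participations e (snd (exponential_search a B)) = 0"
      unfolding ps(1) using tail \<open>e \<notin> set B\<close> ps(3)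
      by (intro participations_search_outside_take[where m = "2 ^ k"]) (auto dest: in_set_takeD)
    ultimately show ?thesis unfolding total by linarith
  next
    case searched
    have once: "participations e (snd (exponential_search a B)) \<le> 1"
      unfolding ps(1) using searched dist ps(2) by (intro participations_search_le_1) auto
    have "e \<in> set B" using searched(2) by (rule in_set_takeD)
    then have "e \<notin> set as" using "3.prems"(1) by (auto simp: B_def)
    \<comment> \<open>Only in the case \<open>kept\<close> can \<open>e\<close> be compared and
      still remain; there the comparison must be paid for.\<close>
    consider (out) "e \<in> set (take l B)"
      | (untouched) "e \<notin> set (take l B)" "e \<notin> set (take (2 ^ k) B)"
      | (kept) "e \<notin> set (take l B)" "e \<in> set (take (2 ^ k) B)"
      by blast
    then show ?thesis
    proof cases
      case out
      then have "e \<notin> set (drop l B)"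
        using set_take_disj_set_drop_if_distinct[OF dist(1) le_refl] by blast
      then have "participations e (snd (exponential_merge (drop l B) as)) = 0"
        using \<open>e \<notin> set as\<close> by (intro participations_exponential_merge_notin)
      with once show ?thesis unfolding total by linarith
    next
      case untouched
      have "participations e (snd (exponential_search a B)) = 0"
        unfolding ps(1) using searched(1) untouched(2) ps(3)
        by (intro participations_search_outside_take[where m = "2 ^ k"]) auto
      moreover have "e \<in> set (take (2 ^ t) (drop l B))"
        using in_set_take_mono[OF in_set_take_drop[OF searched(2) untouched(1)]] by simp
      then have "participations e (snd (exponential_merge (drop l B) as)) \<le> t + 2 * L + 2"
        by (intro IH) simp
      ultimately show ?thesis unfolding total by linarith
    next
      case kept
      show ?thesis
      proof (cases k)
        case 0
        \<comment> \<open>Nothing in front of \<open>e\<close> is output, so \<open>t\<close> need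
          not drop; instead \<open>e\<close> heads the list that searches next.\<close>
        then have "l = 0" "e = b" using ps(4) kept(2) by (auto simp: B_def)
        then have "participations e (snd (exponential_merge (drop l B) as)) \<le> 2 * L + 1"
          using participations_exponential_merge_hd[of b bs as L] dist(3) "3.prems"(2)
          by (auto simp: B_def)
        with once show ?thesis unfolding total by linarith
      next
        case (Suc j)
        then have "2 ^ j \<le> l" using ps(5) by simp
        then have "e \<notin> set (take (2 ^ j) B)"
          using kept(1) in_set_take_mono[of e "2 ^ j" B l] by auto
        \<comment> \<open>The drop from \<open>t\<close> to \<open>j\<close> is strict and pays for
          the one comparison.\<close>
        then have "\<not> t \<le> j"
          using searched(2) in_set_take_mono[of e "2 ^ t" B "2 ^ j"] by auto
        have "e \<in> set (take (2 ^ k - l) (drop l B))"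
          using in_set_take_drop[OF kept(2,1)] .
        \<comment> \<open>Here \<open>2 ^ k - l \<le> 2 ^ j\<close>, because
          \<open>k = Suc j\<close> and \<open>2 ^ j \<le> l\<close>.\<close>
        then have "e \<in> set (take (2 ^ j) (drop l B))"
          by (rule in_set_take_mono) (use Suc \<open>2 ^ j \<le> l\<close> in simp)
        then have "participations e (snd (exponential_merge (drop l B) as)) \<le> j + 2 * L + 2"
          by (intro IH) simp
        with once \<open>\<not> t \<le> j\<close> show ?thesis unfolding total by linarith
      qed
    qed
  qed
qed auto

section \<open>From labelled inputs to the logarithmic bound\<close>

lemma length_label [simp]: "length (label s xs) = length xs"
  by (simp add: label_def)

text \<open>Origin and index tell entries of equal value apart; this supplies the distinctness on
  which the count rests.\<close>

lemma distinct_label_append: "distinct (label First A @ label Second B)"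
  by (auto simp: label_def distinct_map inj_on_def)

lemma exponential_merge_fragile_complexity_le:
  assumes "length A < 2 ^ L" "length B < 2 ^ L"
  shows "exponential_merge_fragile_complexity A B \<le> 3 * L + 2"
proof -
  let ?E = "set (label First A @ label Second B)"
  \<comment> \<open>Both lists are shorter than \<open>2 ^ L\<close>, so \<open>t = L\<close> fits
    every element.\<close>
  have "participations e (snd (exponential_merge (label First A) (label Second B))) \<le> 3 * L + 2"
    if "e \<in> ?E" for e
    using participations_exponential_merge_le[OF distinct_label_append, of A L B e L] that assms
    by simp
  \<comment> \<open>\<open>cSUP_least\<close> requires a nonempty index set; over the empty one the
    supremum of naturals is 0.\<close>
  then show ?thesis
    unfolding exponential_merge_fragile_complexity_def
    by (cases "?E = {}") (auto intro!: cSUP_least simp del: set_append)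
qed

theorem theorem36:
  "\<exists>f \<in> O(\<lambda>n::nat. log 2 (real n)).
     \<forall>n. \<forall>(A::'a::linorder list) (B::'a list).
       length A = n \<longrightarrow> length B = n \<longrightarrow> sorted A \<longrightarrow> sorted B \<longrightarrow>
         real (exponential_merge_fragile_complexity A B) \<le> f n"
proof (rule bexI[of _ "\<lambda>n. 3 * log 2 (real n) + 5"], intro allI impI)
  fix n :: nat and A B :: "'a list"
  assume len: "length A = n" "length B = n"
  show "real (exponential_merge_fragile_complexity A B) \<le> 3 * log 2 (real n) + 5"
  proof (cases "n = 0")
    case True
    \<comment> \<open>Here \<open>L = 0\<close> gives the bound 2, and \<open>log 2 0\<close>
      evaluates to 0.\<close>
    then show ?thesis
      using exponential_merge_fragile_complexity_le[of A 0 B] len by (simp add: log_def)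
  next
    case False
    \<comment> \<open>\<open>L\<close> is the binary logarithm of \<open>n\<close> rounded down. The
      exponent \<open>L + 1\<close> gives \<open>3 * (L + 1) + 2 = 3 * L + 5\<close>, whence the
      chosen bounding function.\<close>
    then obtain L where L: "2 ^ L \<le> n" "n < 2 ^ (L + 1)"
      using ex_power_ivl1[of 2 n] by auto
    have "real (2 ^ L) \<le> real n" using L(1) by (rule of_nat_mono)
    then have "real L \<le> log 2 (real n)"
      using False by (simp add: le_log_iff powr_realpow)
    moreover have "exponential_merge_fragile_complexity A B \<le> 3 * (L + 1) + 2"
      using exponential_merge_fragile_complexity_le[of A "L + 1" B] len L(2) by simp
    then have "real (exponential_merge_fragile_complexity A B) \<le> real (3 * (L + 1) + 2)"
      by (rule of_nat_mono)
    ultimately show ?thesis by simp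
  qed
next
  \<comment> \<open>From \<open>n = 2\<close> on the logarithm is at least 1 and absorbs the
    constant: \<open>8 = 3 + 5\<close>.\<close>
  have "\<forall>\<^sub>F n in sequentially. norm (3 * log 2 (real n) + 5) \<le> 8 * norm (log 2 (real n))"
  proof (rule eventually_sequentiallyI)
    fix n :: nat assume "2 \<le> n"
    then have "1 \<le> log 2 (real n)" by (simp add: le_log_iff)
    then show "norm (3 * log 2 (real n) + 5) \<le> 8 * norm (log 2 (real n))" by simp
  qed
  then show "(\<lambda>n. 3 * log 2 (real n) + 5) \<in> O(\<lambda>n. log 2 (real n))" by (rule bigoI)
qed

end
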